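(* Let $\alpha,\beta$ be irrational real numbers and let $B_m$ and $D_n$ denote the denominators of their $m$th and $n$th convergents. Let $H\ge1$ be an absolute constant and let $a:\mathbb{Z}_{\ge1}\to\mathbb{Z}_{\ge1}$ be a function such that $$\lim_{n\to\infty}\frac{B_{a(n)+1}}{D_n}=0$$ and, for some $n_0\ge1$, the conditions $$B_{a(n)+1}\le D_n,\qquad 4^4H^3D_{n+1}<B_{a(n)}^3$$ hold for all $n\ge n_0$. Assume that there exist an increasing infinite sequence $(n_k)_{k\ge1}$ of positive integers and, for each $k$, an integer vector $(x_k,y_k,z_k,v_k)\in\mathbb{Z}^4$ with $$x_kB_{a(n_k)}+y_kB_{a(n_k)+1}=z_kD_{n_k}+v_kD_{n_k+1},\qquad z_k\ge0,\ v_k\ge0,\ z_k+v_k\ge1,$$ $$1\le\max\{|x_k|,|y_k|,|z_k|,|v_k|\}\le H\cdot J(a(n_k),n_k).$$ Then $\alpha$ and $\beta$ satisfy the Littlewood conjecture, i.e. $\liminf_{q\to\infty}q\,\|q\alpha\|\,\|q\beta\|=0$.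
   Context: For real $x$, $\|x\|:=\min_{k\in\mathbb{Z}}|x-k|$; $q$ ranges over positive integers. For an irrational $\alpha=[b_0;b_1,b_2,\ldots]$ (simple continued fraction, $b_0\in\mathbb{Z}$, $b_n\in\mathbb{Z}_{\ge1}$ for $n\ge1$), the denominators of the convergents are given by $B_0=1$, $B_1=b_1$, $B_{n+2}=b_{n+2}B_{n+1}+B_n$; $D_n$ is defined likewise from the partial quotients of $\beta$. For $m,n\ge1$, $J(m,n):=\left\lfloor(B_m+B_{m+1}+D_n+D_{n+1})^{1/3}\right\rfloor$. *)

theory Defs
  imports "HOL-Library.Extended_Real" "HOL-Library.Liminf_Limsup" Complex_Main
begin

(* Gauss algorithm: for irrational x no complete quotient is an integer, so every
   division below is by a nonzero number and the expansion does not terminate. *)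
primrec cf_complete_quotient :: "real \<Rightarrow> nat \<Rightarrow> real" where
  "cf_complete_quotient x 0 = x"
| "cf_complete_quotient x (Suc n) = 1 / frac (cf_complete_quotient x n)"

definition cf_partial_quotient :: "real \<Rightarrow> nat \<Rightarrow> int" where
  "cf_partial_quotient x n = \<lfloor>cf_complete_quotient x n\<rfloor>"

fun cf_denom :: "real \<Rightarrow> nat \<Rightarrow> int" where
  "cf_denom x 0 = 1"
| "cf_denom x (Suc 0) = cf_partial_quotient x 1"
| "cf_denom x (Suc (Suc n)) =
     cf_partial_quotient x (Suc (Suc n)) * cf_denom x (Suc n) + cf_denom x n"

(* The infimum is a minimum, see dist_to_int_attained. *)
definition dist_to_int :: "real \<Rightarrow> real" where
  "dist_to_int x = (INF k::int. \<bar>x - of_int k\<bar>)"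

definition cf_J :: "real \<Rightarrow> real \<Rightarrow> nat \<Rightarrow> nat \<Rightarrow> int" where
  "cf_J \<alpha> \<beta> m n =
     \<lfloor>root 3 (real_of_int (cf_denom \<alpha> m + cf_denom \<alpha> (m + 1) + cf_denom \<beta> n + cf_denom \<beta> (n + 1)))\<rfloor>"

lemma dist_to_int_le: "dist_to_int x \<le> \<bar>x - of_int k\<bar>"
  unfolding dist_to_int_def by (rule cINF_lower) (auto intro: bdd_belowI[of _ 0])

lemma dist_to_int_attained: "\<exists>k::int. dist_to_int x = \<bar>x - of_int k\<bar>"
proof -
  have "\<bar>x - of_int (round x)\<bar> \<le> \<bar>x - of_int k\<bar>" for k
    using round_diff_minimal[of x k] by simp
  then have "\<bar>x - of_int (round x)\<bar> \<le> dist_to_int x"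
    unfolding dist_to_int_def by (intro cINF_greatest) auto
  with dist_to_int_le[of x "round x"] show ?thesis
    by (intro exI[of _ "round x"]) simp
qed

end

theory Submission imports Defs begin

text \<open>
  Put \<open>m = a n\<close>, let \<open>K\<close> be the maximum of the coefficients of the given relation, and let \<open>q\<close> be
  its common value. From \<open>q = x B\<^sub>m + y B\<^sub>m\<^sub>+\<^sub>1\<close> one gets \<open>q \<le> 2 K B\<^sub>m\<^sub>+\<^sub>1\<close> and
  \<open>\<parallel>q \<alpha>\<parallel> \<le> 2 K / B\<^sub>m\<^sub>+\<^sub>1\<close>. Since \<open>(z + v) D\<^sub>n \<le> q \<le> 2 K B\<^sub>m\<^sub>+\<^sub>1\<close>, the sum \<open>z + v\<close> is at most
  \<open>2 K \<epsilon>\<close>, where \<open>\<epsilon> = B\<^sub>m\<^sub>+\<^sub>1 / D\<^sub>n\<close> tends to zero, and so \<open>\<parallel>q \<beta>\<parallel> \<le> 2 K \<epsilon> / D\<^sub>n\<^sub>+\<^sub>1\<close>. The product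
  of the three bounds is \<open>8 K\<^sup>3 \<epsilon> / D\<^sub>n\<^sub>+\<^sub>1\<close>, and \<open>K\<^sup>3 \<le> 4 H\<^sup>3 D\<^sub>n\<^sub>+\<^sub>1\<close> by the choice of \<open>J\<close>.
\<close>

section \<open>Complete and partial quotients of an irrational number\<close>

lemma frac_notin_Rats:
  fixes x :: real
  assumes "x \<notin> \<rat>"
  shows "frac x \<notin> \<rat>"
proof
  assume "frac x \<in> \<rat>"
  then have "frac x + of_int \<lfloor>x\<rfloor> \<in> \<rat>"
    by (intro Rats_add Rats_of_int)
  with assms show False
    by (simp add: frac_def)
qed

text \<open>Ensures that the Gauss algorithm never divides by zero: no fractional part that occurs
  is rational.\<close>

lemma cf_complete_quotient_notin_Rats:
  assumes "x \<notin> \<rat>"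
  shows "cf_complete_quotient x n \<notin> \<rat>"
proof (induction n)
  case (Suc n)
  show ?case
  proof
    assume "cf_complete_quotient x (Suc n) \<in> \<rat>"
    then have "1 / cf_complete_quotient x (Suc n) \<in> \<rat>"
      by (intro Rats_divide Rats_1)
    with frac_notin_Rats[OF Suc.IH] show False
      by simp
  qed
qed (use assms in simp)

lemma cf_complete_quotient_Suc_gt_1:
  assumes "x \<notin> \<rat>"
  shows "cf_complete_quotient x (Suc n) > 1"
proof -
  have "frac (cf_complete_quotient x n) \<noteq> 0"
    using frac_notin_Rats[OF cf_complete_quotient_notin_Rats[OF assms]] by (metis Rats_0)
  then have "0 < frac (cf_complete_quotient x n)"
    by (simp add: less_le)
  then show ?thesis
    by (simp add: frac_lt_1)
qed

text \<open>Both sides are the fractional part, taken back from its reciprocal; by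
  \<open>1 / 0 = 0\<close> this covers integral quotients too.\<close>

lemma cf_complete_quotient_minus_partial_quotient:
  "cf_complete_quotient x n - of_int (cf_partial_quotient x n) = 1 / cf_complete_quotient x (Suc n)"
  by (simp add: cf_partial_quotient_def frac_def)

lemma cf_partial_quotient_Suc_ge_1:
  assumes "x \<notin> \<rat>"
  shows "cf_partial_quotient x (Suc n) \<ge> 1"
  using cf_complete_quotient_Suc_gt_1[OF assms, of n] by (simp add: cf_partial_quotient_def)

section \<open>Growth of the denominators\<close>

lemma cf_denom_pos_mono:
  assumes "x \<notin> \<rat>"
  shows "cf_denom x n \<ge> 1 \<and> cf_denom x n \<le> cf_denom x (Suc n)"
proof (induction n)
  case 0
  then show ?case
    using cf_partial_quotient_Suc_ge_1[OF assms, of 0] by simp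
next
  case (Suc n)
  have "1 * cf_denom x (Suc n) \<le> cf_partial_quotient x (Suc (Suc n)) * cf_denom x (Suc n)"
    using Suc cf_partial_quotient_Suc_ge_1[OF assms] by (intro mult_right_mono) auto
  with Suc show ?case
    unfolding cf_denom.simps(3) by linarith
qed

text \<open>Each step adds an earlier denominator, hence at least 1. This later makes the numbers
  \<open>q\<close> unbounded.\<close>

lemma cf_denom_ge_index:
  assumes "x \<notin> \<rat>"
  shows "cf_denom x n \<ge> int n"
proof (induction n)
  case (Suc n)
  show ?case
  proof (cases n)
    case 0
    then show ?thesis
      using cf_partial_quotient_Suc_ge_1[OF assms, of 0] by simp
  next
    case (Suc m)
    have "1 * cf_denom x n \<le> cf_partial_quotient x (Suc n) * cf_denom x n"
      using cf_denom_pos_mono[OF assms, of n] cf_partial_quotient_Suc_ge_1[OF assms]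
      by (intro mult_right_mono) auto
    then have "cf_denom x (Suc n) \<ge> cf_denom x n + cf_denom x m"
      unfolding Suc cf_denom.simps(3) by linarith
    then show ?thesis
      using Suc.IH cf_denom_pos_mono[OF assms, of m] by linarith
  qed
qed simp

section \<open>Quality of approximation by convergents\<close>

text \<open>Multiplying the identity by the next complete quotient \<open>c\<close> and splitting
  \<open>c\<close> into its integer part and a reciprocal reproduces the recursion of the
  denominators.\<close>

lemma cf_denom_complete_quotient_prod:
  assumes "x \<notin> \<rat>"
  shows "of_int (cf_denom x (Suc n)) + of_int (cf_denom x n) / cf_complete_quotient x (Suc (Suc n))
         = (\<Prod>i\<le>n. cf_complete_quotient x (Suc i))"
proof (induction n)
  case 0
  show ?case
    using cf_complete_quotient_minus_partial_quotient[of x 1] by (simp del: cf_complete_quotient.simps)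
next
  case (Suc n)
  define c where "c = cf_complete_quotient x (Suc (Suc n))"
  define b :: real where "b = of_int (cf_partial_quotient x (Suc (Suc n)))"
  have "c > 1"
    using cf_complete_quotient_Suc_gt_1[OF assms] by (simp only: c_def)
  have cb: "1 / cf_complete_quotient x (Suc (Suc (Suc n))) = c - b"
    using cf_complete_quotient_minus_partial_quotient[of x "Suc (Suc n)"] by (simp only: c_def b_def)
  have "of_int (cf_denom x (Suc (Suc n)))
          + of_int (cf_denom x (Suc n)) * (1 / cf_complete_quotient x (Suc (Suc (Suc n))))
        = c * (of_int (cf_denom x (Suc n)) + of_int (cf_denom x n) / c)"
    unfolding cb using \<open>c > 1\<close> by (simp add: b_def field_simps)
  also have "\<dots> = c * (\<Prod>i\<le>n. cf_complete_quotient x (Suc i))"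
    using Suc.IH by (simp only: c_def)
  finally show ?case
    by (simp add: c_def mult.commute del: cf_complete_quotient.simps cf_denom.simps)
qed

text \<open>The witnesses are the numerators of the convergents. The recursion has order two, so the
  induction carries two consecutive errors, which obey the recursion of the denominators.\<close>

lemma cf_denom_approx_exact:
  assumes "x \<notin> \<rat>"
  shows "\<exists>p p' :: int.
    of_int (cf_denom x n) * x - of_int p = (-1) ^ n / (\<Prod>i\<le>n. cf_complete_quotient x (Suc i)) \<and>
    of_int (cf_denom x (Suc n)) * x - of_int p'
      = (-1) ^ Suc n / (\<Prod>i\<le>Suc n. cf_complete_quotient x (Suc i))"
proof (induction n)
  case 0
  define c where "c = cf_complete_quotient x (Suc 0)"
  define b where "b = cf_partial_quotient x 0"
  define b' where "b' = cf_partial_quotient x (Suc 0)"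
  have "c > 1"
    using cf_complete_quotient_Suc_gt_1[OF assms] by (simp only: c_def)
  have e: "x - of_int b = 1 / c" "1 / cf_complete_quotient x (Suc (Suc 0)) = c - of_int b'"
    using cf_complete_quotient_minus_partial_quotient[of x 0]
      cf_complete_quotient_minus_partial_quotient[of x "Suc 0"]
    by (simp_all add: c_def b_def b'_def del: cf_complete_quotient.simps(2))
  \<comment> \<open>\<open>b' * b + 1\<close> is the numerator of the first convergent.\<close>
  then have "of_int b' * x - of_int (b' * b + 1) = of_int b' * (1 / c) - 1"
    by (simp add: algebra_simps flip: e(1))
  also have "\<dots> = - (1 / c * (1 / cf_complete_quotient x (Suc (Suc 0))))"
    unfolding e(2) using \<open>c > 1\<close> by (simp add: field_simps)
  finally have "of_int b' * x - of_int (b' * b + 1)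
      = - (1 / c * (1 / cf_complete_quotient x (Suc (Suc 0))))" .
  with e(1) show ?case
    by (intro exI[of _ b] exI[of _ "b' * b + 1"])
      (simp add: b'_def c_def del: cf_complete_quotient.simps)
next
  case (Suc n)
  then obtain p p' :: int where p:
    "of_int (cf_denom x n) * x - of_int p = (-1) ^ n / (\<Prod>i\<le>n. cf_complete_quotient x (Suc i))"
    "of_int (cf_denom x (Suc n)) * x - of_int p'
      = (-1) ^ Suc n / (\<Prod>i\<le>Suc n. cf_complete_quotient x (Suc i))"
    by blast
  define P where "P = (\<Prod>i\<le>n. cf_complete_quotient x (Suc i))"
  define c where "c = cf_complete_quotient x (Suc (Suc n))"
  define d where "d = cf_complete_quotient x (Suc (Suc (Suc n)))"
  define b where "b = cf_partial_quotient x (Suc (Suc n))"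
  have "c > 1" "d > 1"
    using cf_complete_quotient_Suc_gt_1[OF assms] by (simp_all only: c_def d_def)
  have "P > 0"
    unfolding P_def using cf_complete_quotient_Suc_gt_1[OF assms]
    by (intro prod_pos) (meson less_trans zero_less_one)
  have d: "1 / d = c - of_int b"
    using cf_complete_quotient_minus_partial_quotient[of x "Suc (Suc n)"]
    by (simp only: b_def c_def d_def)
  have P: "(\<Prod>i\<le>Suc n. cf_complete_quotient x (Suc i)) = P * c"
    "(\<Prod>i\<le>Suc (Suc n). cf_complete_quotient x (Suc i)) = P * c * d"
    by (simp_all add: P_def c_def d_def mult.assoc del: cf_complete_quotient.simps)
  have "of_int (cf_denom x (Suc (Suc n))) * x - of_int (b * p' + p)
      = of_int b * (of_int (cf_denom x (Suc n)) * x - of_int p')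
        + (of_int (cf_denom x n) * x - of_int p)"
    by (simp add: b_def algebra_simps)
  also have "\<dots> = of_int b * ((-1) ^ Suc n / (P * c)) + (-1) ^ n / P"
    unfolding p P by (simp add: P_def)
  \<comment> \<open>Over the common denominator \<open>P * c\<close> the numerator is
    \<open>(-1) ^ n * (c - b)\<close>, and \<open>c - b\<close> is \<open>1 / d\<close>.\<close>
  also have "\<dots> = (-1) ^ n / (P * c) * (1 / d)"
    unfolding d using \<open>c > 1\<close> \<open>P > 0\<close> by (simp add: field_simps)
  finally have "of_int (cf_denom x (Suc (Suc n))) * x - of_int (b * p' + p)
      = (-1) ^ Suc (Suc n) / (\<Prod>i\<le>Suc (Suc n). cf_complete_quotient x (Suc i))"
    unfolding P by simp
  with p(2) show ?case
    by blast
qed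

text \<open>The exact error is the reciprocal of the product of complete quotients, and that product
  exceeds the next denominator by a nonnegative term.\<close>

lemma cf_denom_approx:
  assumes "x \<notin> \<rat>"
  obtains p :: int where
    "\<bar>of_int (cf_denom x n) * x - of_int p\<bar> \<le> 1 / of_int (cf_denom x (Suc n))"
proof -
  obtain p :: int where p: "of_int (cf_denom x n) * x - of_int p
      = (-1) ^ n / (\<Prod>i\<le>n. cf_complete_quotient x (Suc i))"
    using cf_denom_approx_exact[OF assms] by blast
  have B: "cf_denom x n \<ge> 1" "cf_denom x (Suc n) \<ge> 1"
    using cf_denom_pos_mono[OF assms] by auto
  have "of_int (cf_denom x n) / cf_complete_quotient x (Suc (Suc n)) \<ge> 0"
    using B cf_complete_quotient_Suc_gt_1[OF assms, of "Suc n"]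
    by (intro divide_nonneg_nonneg) auto
  then have le: "of_int (cf_denom x (Suc n)) \<le> (\<Prod>i\<le>n. cf_complete_quotient x (Suc i))"
    unfolding cf_denom_complete_quotient_prod[OF assms, symmetric] by linarith
  have "real_of_int (cf_denom x (Suc n)) > 0"
    using B by simp
  with le have "\<bar>of_int (cf_denom x n) * x - of_int p\<bar> \<le> 1 / of_int (cf_denom x (Suc n))"
    unfolding p abs_divide power_abs by (simp add: frac_le del: cf_complete_quotient.simps cf_denom.simps)
  with that show thesis
    by blast
qed

section \<open>Integer combinations of two consecutive denominators\<close>

lemma dist_to_int_nonneg: "dist_to_int x \<ge> 0"
  using dist_to_int_attained[of x] by auto

text \<open>The same combination of the numerators is a nearby integer. Serves \<alpha> with
  \<open>x\<close>, \<open>y\<close> and \<beta> with \<open>z\<close>, \<open>v\<close>; keeping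
  the coefficients in the bound is what lets a small \<open>z + v\<close> pay off.\<close>

lemma dist_to_int_cf_denom_combination:
  assumes "\<alpha> \<notin> \<rat>"
  shows "dist_to_int (of_int (x * cf_denom \<alpha> n + y * cf_denom \<alpha> (n + 1)) * \<alpha>)
         \<le> of_int (\<bar>x\<bar> + \<bar>y\<bar>) / of_int (cf_denom \<alpha> (n + 1))"
proof -
  let ?B = "\<lambda>n. real_of_int (cf_denom \<alpha> n)"
  obtain p where p: "\<bar>?B n * \<alpha> - of_int p\<bar> \<le> 1 / ?B (Suc n)"
    using cf_denom_approx[OF assms] .
  obtain p' where p': "\<bar>?B (Suc n) * \<alpha> - of_int p'\<bar> \<le> 1 / ?B (Suc (Suc n))"
    using cf_denom_approx[OF assms] .
  have B: "cf_denom \<alpha> (Suc n) \<ge> 1" "cf_denom \<alpha> (Suc n) \<le> cf_denom \<alpha> (Suc (Suc n))"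
    using cf_denom_pos_mono[OF assms] by blast+
  then have "1 / ?B (Suc (Suc n)) \<le> 1 / ?B (Suc n)"
    by (intro frac_le) (auto simp del: cf_denom.simps)
  with p' have p'': "\<bar>?B (Suc n) * \<alpha> - of_int p'\<bar> \<le> 1 / ?B (Suc n)"
    by linarith
  have "dist_to_int (of_int (x * cf_denom \<alpha> n + y * cf_denom \<alpha> (n + 1)) * \<alpha>)
      \<le> \<bar>of_int (x * cf_denom \<alpha> n + y * cf_denom \<alpha> (n + 1)) * \<alpha> - of_int (x * p + y * p')\<bar>"
    by (rule dist_to_int_le)
  also have "\<dots> = \<bar>of_int x * (?B n * \<alpha> - of_int p) + of_int y * (?B (Suc n) * \<alpha> - of_int p')\<bar>"
    by (simp add: algebra_simps)
  also have "\<dots> \<le> \<bar>of_int x\<bar> * \<bar>?B n * \<alpha> - of_int p\<bar> + \<bar>of_int y\<bar> * \<bar>?B (Suc n) * \<alpha> - of_int p'\<bar>"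
    by (metis abs_mult abs_triangle_ineq)
  also have "\<dots> \<le> \<bar>of_int x\<bar> * (1 / ?B (Suc n)) + \<bar>of_int y\<bar> * (1 / ?B (Suc n))"
    using p p'' by (intro add_mono mult_left_mono) auto
  also have "\<dots> = of_int (\<bar>x\<bar> + \<bar>y\<bar>) / ?B (n + 1)"
    by (simp add: add_divide_distrib)
  finally show ?thesis .
qed

section \<open>Bounding the Littlewood product\<close>

text \<open>The real arithmetic, freed from continued fractions: \<open>s\<close> and
  \<open>t\<close> stand for the two distances, and \<open>C\<close> will be
  \<open>4 * H ^ 3\<close>.\<close>

lemma product_bound_of_relation:
  fixes q x y z v B B' D D' K C e s t :: real
  assumes q: "q = x * B + y * B'" "q = z * D + v * D'"
    and le: "\<bar>x\<bar> \<le> K" "\<bar>y\<bar> \<le> K" "z \<ge> 0" "v \<ge> 0"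
    and K: "K ^ 3 \<le> C * D'"
    and BD: "0 < B" "B \<le> B'" "B' \<le> e * D" "0 < D" "D \<le> D'"
    and s: "0 \<le> s" "s \<le> (\<bar>x\<bar> + \<bar>y\<bar>) / B'"
    and t: "0 \<le> t" "t \<le> (z + v) / D'"
  shows "q * s * t \<le> 8 * C * e"
proof -
  have pos: "K \<ge> 0" "B' > 0" "D' > 0"
    using le BD by auto
  have "e \<ge> 0"
    using pos BD by (metis less_le_trans less_imp_le zero_less_mult_pos2)
  have "q \<le> \<bar>x\<bar> * B + \<bar>y\<bar> * B'"
    unfolding q(1) using pos BD by (intro add_mono mult_right_mono) auto
  also have "\<dots> \<le> K * B' + K * B'"
    using pos BD le by (intro add_mono mult_mono) auto
  finally have qK: "q \<le> 2 * K * B'"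
    by (simp add: mult_ac)
  \<comment> \<open>The signs of \<open>z\<close> and \<open>v\<close> exclude cancellation, so the
    size of \<open>q\<close> limits \<open>z + v\<close>.\<close>
  have "(z + v) * D \<le> q"
    unfolding q(2) using BD le mult_left_mono[of D D' v] by (simp add: algebra_simps)
  also have "\<dots> \<le> 2 * K * (e * D)"
    using qK BD(3) pos by (meson mult_left_mono mult_nonneg_nonneg order_trans zero_le_numeral)
  finally have zv: "z + v \<le> 2 * K * e"
    using BD by (simp add: mult.assoc[symmetric])
  have "s \<le> 2 * K / B'"
    using s(2) le pos by (intro order_trans[OF s(2)] divide_right_mono) auto
  moreover have "t \<le> 2 * K * e / D'"
    using zv pos by (intro order_trans[OF t(2)] divide_right_mono) auto
  ultimately have "q * s * t \<le> (2 * K * B') * (2 * K / B') * (2 * K * e / D')"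
    using qK s(1) t(1) pos \<open>e \<ge> 0\<close> by (intro mult_mono) auto
  also have "\<dots> = 8 * e * (K ^ 3 / D')"
    using pos by (simp add: power3_eq_cube)
  also have "\<dots> \<le> 8 * e * C"
    using K pos \<open>e \<ge> 0\<close> by (intro mult_left_mono) (auto simp: divide_le_eq)
  finally show ?thesis
    by (simp add: mult_ac)
qed

lemma littlewood_product_bound:
  fixes x y z v :: int and K H e :: real
  assumes irr: "\<alpha> \<notin> \<rat>" "\<beta> \<notin> \<rat>" and "H \<ge> 0"
    and BD: "cf_denom \<alpha> (m + 1) \<le> cf_denom \<beta> n"
    and e: "cf_denom \<alpha> (m + 1) \<le> e * cf_denom \<beta> n"
    and eq: "x * cf_denom \<alpha> m + y * cf_denom \<alpha> (m + 1) = z * cf_denom \<beta> n + v * cf_denom \<beta> (n + 1)"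
    and zv: "z \<ge> 0" "v \<ge> 0" "z + v \<ge> 1"
    and K: "\<bar>x\<bar> \<le> K" "\<bar>y\<bar> \<le> K" "K \<le> H * cf_J \<alpha> \<beta> m n"
  obtains q :: nat where "q \<ge> n"
    "real q * dist_to_int (real q * \<alpha>) * dist_to_int (real q * \<beta>) \<le> 32 * H ^ 3 * e"
proof -
  let ?B = "cf_denom \<alpha>" and ?D = "cf_denom \<beta>"
  have B: "?B m \<ge> 1" "?B m \<le> ?B (m + 1)"
    using cf_denom_pos_mono[OF irr(1), of m] by auto
  have D: "?D n \<ge> 1" "?D n \<le> ?D (n + 1)"
    using cf_denom_pos_mono[OF irr(2), of n] by auto
  \<comment> \<open>The relation's common value is at least \<open>n\<close>, so \<open>nat\<close>
    truncates nothing.\<close>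
  define q where "q = nat (z * ?D n + v * ?D (n + 1))"
  have "int n \<le> 1 * ?D n"
    using cf_denom_ge_index[OF irr(2)] by simp
  also have "\<dots> \<le> (z + v) * ?D n"
    using zv D by (intro mult_right_mono) auto
  also have "\<dots> \<le> z * ?D n + v * ?D (n + 1)"
    using zv D mult_left_mono[of "?D n" "?D (n + 1)" v] by (simp add: algebra_simps)
  finally have n: "int n \<le> z * ?D n + v * ?D (n + 1)" .
  then have q: "int q = z * ?D n + v * ?D (n + 1)"
    by (simp add: q_def)
  then have rq: "real q = of_int (x * ?B m + y * ?B (m + 1))"
    "real q = of_int (z * ?D n + v * ?D (n + 1))"
    using eq by (metis of_int_of_nat_eq)+

  have "cf_J \<alpha> \<beta> m n \<le> root 3 (of_int (?B m + ?B (m + 1) + ?D n + ?D (n + 1)))"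
    unfolding cf_J_def by (rule of_int_floor_le)
  \<comment> \<open>The last of the four denominators is the largest, because
    \<open>?B (m + 1)\<close> is at most \<open>?D n\<close>.\<close>
  also have "\<dots> \<le> root 3 (4 * of_int (?D (n + 1)))"
    using B D BD by (simp del: of_int_add)
  finally have "K \<le> H * root 3 (4 * of_int (?D (n + 1)))"
    using K(3) \<open>H \<ge> 0\<close> by (meson mult_left_mono order_trans)
  moreover have "K \<ge> 0"
    using K(1) by linarith
  ultimately have "K ^ 3 \<le> (H * root 3 (4 * of_int (?D (n + 1)))) ^ 3"
    by (intro power_mono)
  also have "\<dots> = 4 * H ^ 3 * of_int (?D (n + 1))"
    using D by (simp add: power_mult_distrib)
  finally have K3: "K ^ 3 \<le> 4 * H ^ 3 * of_int (?D (n + 1))" .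

  have "real q * dist_to_int (real q * \<alpha>) * dist_to_int (real q * \<beta>) \<le> 8 * (4 * H ^ 3) * e"
  proof (rule product_bound_of_relation[where x = "of_int x" and y = "of_int y" and z = "of_int z"
        and v = "of_int v" and B = "of_int (?B m)" and B' = "of_int (?B (m + 1))"
        and D = "of_int (?D n)" and D' = "of_int (?D (n + 1))" and K = K])
    show "dist_to_int (real q * \<alpha>) \<le> (\<bar>of_int x\<bar> + \<bar>of_int y\<bar>) / of_int (?B (m + 1))"
      unfolding rq(1) using dist_to_int_cf_denom_combination[OF irr(1), of x m y] by simp
    show "dist_to_int (real q * \<beta>) \<le> (of_int z + of_int v) / of_int (?D (n + 1))"
      unfolding rq(2) using dist_to_int_cf_denom_combination[OF irr(2), of z n v] zv by simp
    show "real q = of_int x * of_int (?B m) + of_int y * of_int (?B (m + 1))"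
      using rq(1) by simp
    show "real q = of_int z * of_int (?D n) + of_int v * of_int (?D (n + 1))"
      using rq(2) by simp
  qed (use B D e K K3 zv dist_to_int_nonneg in auto)
  then show thesis
    using n q by (intro that[of q]) auto
qed

section \<open>Passage to the limit inferior\<close>

lemma liminf_ereal_eq_0I:
  fixes f :: "nat \<Rightarrow> real"
  assumes nonneg: "\<And>n. f n \<ge> 0"
    and small: "\<And>e N. e > 0 \<Longrightarrow> \<exists>n\<ge>N. f n \<le> e"
  shows "liminf (\<lambda>n. ereal (f n)) = 0"
proof (rule antisym)
  show "0 \<le> liminf (\<lambda>n. ereal (f n))"
    using nonneg by (intro Liminf_bounded) auto
  show "liminf (\<lambda>n. ereal (f n)) \<le> 0"
  proof (rule ccontr)
    assume "\<not> liminf (\<lambda>n. ereal (f n)) \<le> 0"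
    \<comment> \<open>Density supplies a real \<open>c\<close> even if the limit inferior is
      infinite; \<open>f\<close> would eventually stay above it.\<close>
    then obtain c where c: "0 < ereal c" "ereal c < liminf (\<lambda>n. ereal (f n))"
      using ereal_dense2[of 0 "liminf (\<lambda>n. ereal (f n))"] by (auto simp: not_le)
    then obtain N where "\<And>n. n \<ge> N \<Longrightarrow> c < f n"
      using less_LiminfD[OF c(2)] by (auto simp: eventually_sequentially)
    with small[of c N] c(1) show False
      by force
  qed
qed

theorem theorem16:
  fixes \<alpha> \<beta> H :: real and a :: "nat \<Rightarrow> nat" and B D :: "nat \<Rightarrow> int"
  defines "B \<equiv> cf_denom \<alpha>" and "D \<equiv> cf_denom \<beta>"
  assumes "\<alpha> \<notin> \<rat>" and "\<beta> \<notin> \<rat>"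
    and "H \<ge> 1"
    and "\<forall>n\<ge>1. a n \<ge> 1"
    and "(\<lambda>n. real_of_int (B (a n + 1)) / real_of_int (D n)) \<longlonglongrightarrow> 0"
    and "\<exists>n0\<ge>1. \<forall>n\<ge>n0. B (a n + 1) \<le> D n
           \<and> 4 ^ 4 * H ^ 3 * real_of_int (D (n + 1)) < real_of_int (B (a n)) ^ 3"
    and "\<exists>nk :: nat \<Rightarrow> nat. strict_mono_on {1..} nk \<and> (\<forall>k\<ge>1. nk k \<ge> 1) \<and>
           (\<forall>k\<ge>1. \<exists>x y z v :: int.
              x * B (a (nk k)) + y * B (a (nk k) + 1) = z * D (nk k) + v * D (nk k + 1)
              \<and> z \<ge> 0 \<and> v \<ge> 0 \<and> z + v \<ge> 1
              \<and> 1 \<le> Max {\<bar>x\<bar>, \<bar>y\<bar>, \<bar>z\<bar>, \<bar>v\<bar>}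
              \<and> real_of_int (Max {\<bar>x\<bar>, \<bar>y\<bar>, \<bar>z\<bar>, \<bar>v\<bar>})
                  \<le> H * real_of_int (cf_J \<alpha> \<beta> (a (nk k)) (nk k)))"
  shows "liminf (\<lambda>q::nat. ereal (real q * dist_to_int (real q * \<alpha>) * dist_to_int (real q * \<beta>))) = 0"
proof (rule liminf_ereal_eq_0I)
  show "real q * dist_to_int (real q * \<alpha>) * dist_to_int (real q * \<beta>) \<ge> 0" for q
    by (simp add: dist_to_int_nonneg)
next
  fix \<epsilon> :: real and N :: nat
  assume "\<epsilon> > 0"
  \<comment> \<open>Chosen so that the bound \<open>32 * H ^ 3 * e\<close> becomes
    \<epsilon>.\<close>
  define e where "e = \<epsilon> / (32 * H ^ 3)"
  have "e > 0"
    using \<open>\<epsilon> > 0\<close> \<open>H \<ge> 1\<close> by (simp add: e_def)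
  from order_tendstoD(2)[OF assms(7) this] obtain M
    where M: "\<And>n. n \<ge> M \<Longrightarrow> real_of_int (B (a n + 1)) / real_of_int (D n) < e"
    by (auto simp: eventually_sequentially)
  obtain n0 where n0: "\<And>n. n \<ge> n0 \<Longrightarrow> B (a n + 1) \<le> D n"
    using assms(8) by blast
  obtain nk :: "nat \<Rightarrow> nat" where nk: "strict_mono_on {1..} nk" and
    rel: "\<And>k. k \<ge> 1 \<Longrightarrow> \<exists>x y z v :: int.
              x * B (a (nk k)) + y * B (a (nk k) + 1) = z * D (nk k) + v * D (nk k + 1)
              \<and> z \<ge> 0 \<and> v \<ge> 0 \<and> z + v \<ge> 1
              \<and> 1 \<le> Max {\<bar>x\<bar>, \<bar>y\<bar>, \<bar>z\<bar>, \<bar>v\<bar>}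
              \<and> real_of_int (Max {\<bar>x\<bar>, \<bar>y\<bar>, \<bar>z\<bar>, \<bar>v\<bar>})
                  \<le> H * real_of_int (cf_J \<alpha> \<beta> (a (nk k)) (nk k))"
    using assms(9) by blast
  \<comment> \<open>\<open>nk\<close> is strictly increasing from index 1 on; shifted by
    \<open>Suc\<close> it is so on all naturals and dominates its argument.\<close>
  define k where "k = Suc (max N (max M n0))"
  have "strict_mono (\<lambda>k. nk (Suc k))"
    using nk by (auto simp: strict_mono_on_def strict_mono_def)
  then have "nk k \<ge> max N (max M n0)"
    unfolding k_def by (rule strict_mono_imp_increasing)
  then have ge: "nk k \<ge> N" "nk k \<ge> M" "nk k \<ge> n0"
    by auto
  obtain x y z v :: int where r:
    "x * B (a (nk k)) + y * B (a (nk k) + 1) = z * D (nk k) + v * D (nk k + 1)"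
    "z \<ge> 0" "v \<ge> 0" "z + v \<ge> 1"
    "real_of_int (Max {\<bar>x\<bar>, \<bar>y\<bar>, \<bar>z\<bar>, \<bar>v\<bar>}) \<le> H * real_of_int (cf_J \<alpha> \<beta> (a (nk k)) (nk k))"
    using rel[of k] by (auto simp: k_def)
  have "D (nk k) \<ge> 1"
    using cf_denom_pos_mono[OF assms(4)] by (simp add: D_def)
  then have e: "real_of_int (B (a (nk k) + 1)) \<le> e * real_of_int (D (nk k))"
    using M[OF ge(2)] by (simp add: divide_less_eq)
  \<comment> \<open>The maximum of the coefficients plays the part of \<open>K\<close>.\<close>
  have xy: "real_of_int \<bar>x\<bar> \<le> real_of_int (Max {\<bar>x\<bar>, \<bar>y\<bar>, \<bar>z\<bar>, \<bar>v\<bar>})"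
    "real_of_int \<bar>y\<bar> \<le> real_of_int (Max {\<bar>x\<bar>, \<bar>y\<bar>, \<bar>z\<bar>, \<bar>v\<bar>})"
    unfolding of_int_le_iff by (intro Max_ge; simp)+
  obtain q where "q \<ge> nk k"
    "real q * dist_to_int (real q * \<alpha>) * dist_to_int (real q * \<beta>) \<le> 32 * H ^ 3 * e"
    by (rule littlewood_product_bound[OF assms(3,4) _ n0[OF ge(3), unfolded B_def D_def]
          e[unfolded B_def D_def] r(1)[unfolded B_def D_def] r(2-4) xy r(5)])
      (use \<open>H \<ge> 1\<close> in auto)
  moreover have "32 * H ^ 3 * e = \<epsilon>"
    using \<open>H \<ge> 1\<close> by (simp add: e_def)
  ultimately show "\<exists>q\<ge>N. real q * dist_to_int (real q * \<alpha>) * dist_to_int (real q * \<beta>) \<le> \<epsilon>"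
    using ge(1) by (metis order_trans)
qed

end
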